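(* For $A,B\in M_n^{+}(\mathbb{C})$ let $$J_\eta(A,B):=\frac12\operatorname{Tr}(\eta(A))+\frac12\operatorname{Tr}(\eta(B))-\operatorname{Tr}\!\left(\eta\!\left(\frac{A+B}{2}\right)\right),$$ where $\eta(x)=x\log x$ for $x>0$ and $\eta(0)=0$, and consider the metric $\sqrt{J_\eta}$ on $M_n^{+}(\mathbb{C})$. (1) If $n\ge 2$, then $\sqrt{J_\eta}$ is not Hilbertian on $M_n^{++}(\mathbb{C})$. Consequently, it is not Hilbertian on $M_n^{+}(\mathbb{C})$. (2) If $n\ge 3$, then $\sqrt{J_\eta}$ is not Hilbertian on the set of density matrices $\mathcal{D}_n:=\{\rho\in M_n^{+}(\mathbb{C}):\operatorname{Tr}(\rho)=1\}$.
   Context: $M_n^{+}(\mathbb{C})$ (resp. $M_n^{++}(\mathbb{C})$) denotes the set of $n\times n$ complex positive semidefinite (resp. positive definite) matrices. Functions of matrices are defined by functional calculus. A metric $d$ on a set $X$ is called Hilbertian if there exist a Hilbert space $\mathcal{H}$ and a map $\Phi:X\to\mathcal{H}$ such that $d(x,y)=\|\Phi(x)-\Phi(y)\|_{\mathcal{H}}$ for all $x,y\in X$. It is known (Virosztek) that $\sqrt{J_\eta}$ is a metric on $M_n^{+}(\mathbb{C})$. *)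

theory Defs
  imports
    "HOL-Analysis.Inner_Product"
    "Jordan_Normal_Form.Schur_Decomposition"
begin

definition mat_trace :: "'a::comm_monoid_add mat \<Rightarrow> 'a" where
  "mat_trace A = (\<Sum>i<dim_row A. A $$ (i, i))"

definition hermitian_mat :: "complex mat \<Rightarrow> bool" where
  "hermitian_mat A \<longleftrightarrow> mat_adjoint A = A"

definition unitary_mats :: "nat \<Rightarrow> complex mat set" where
  "unitary_mats n =
     {U \<in> carrier_mat n n. mat_adjoint U * U = 1\<^sub>m n \<and> U * mat_adjoint U = 1\<^sub>m n}"

definition psd_mats :: "nat \<Rightarrow> complex mat set" where
  "psd_mats n = {A \<in> carrier_mat n n. hermitian_mat A \<and>
     (\<forall>v \<in> carrier_vec n. 0 \<le> Re ((A *\<^sub>v v) \<bullet>c v))}"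

definition pd_mats :: "nat \<Rightarrow> complex mat set" where
  "pd_mats n = {A \<in> carrier_mat n n. hermitian_mat A \<and>
     (\<forall>v \<in> carrier_vec n. v \<noteq> 0\<^sub>v n \<longrightarrow> 0 < Re ((A *\<^sub>v v) \<bullet>c v))}"

definition density_mats :: "nat \<Rightarrow> complex mat set" where
  "density_mats n = {\<rho> \<in> psd_mats n. mat_trace \<rho> = 1}"

definition is_diagonalization :: "complex mat \<Rightarrow> complex mat \<Rightarrow> (nat \<Rightarrow> real) \<Rightarrow> bool" where
  "is_diagonalization A U d \<longleftrightarrow> U \<in> unitary_mats (dim_row A) \<and>
     A = U * mat_diag (dim_row A) (\<lambda>i. complex_of_real (d i)) * mat_adjoint U"

text \<open>Functional calculus \<open>f (U diag(d) U\<^sup>*) = U diag(f d) U\<^sup>*\<close>, meaningful for Hermitian arguments;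
  the result does not depend on the diagonalization (\<open>mat_fun_eq\<close> below).\<close>

definition mat_fun :: "(real \<Rightarrow> real) \<Rightarrow> complex mat \<Rightarrow> complex mat" where
  "mat_fun f A = (THE M. \<exists>U d. is_diagonalization A U d \<and>
     M = U * mat_diag (dim_row A) (\<lambda>i. complex_of_real (f (d i))) * mat_adjoint U)"

definition eta :: "real \<Rightarrow> real" where
  "eta x = (if x > 0 then x * ln x else 0)"

text \<open>The traces below are real for Hermitian \<open>A\<close> and \<open>B\<close>; \<open>Re\<close> only changes the type.\<close>

definition J_eta :: "complex mat \<Rightarrow> complex mat \<Rightarrow> real" where
  "J_eta A B = 1/2 * Re (mat_trace (mat_fun eta A)) + 1/2 * Re (mat_trace (mat_fun eta B))
     - Re (mat_trace (mat_fun eta ((1/2) \<cdot>\<^sub>m (A + B))))"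

text \<open>HOL cannot quantify over types inside a formula, so the Hilbert space is a parameter:
  \<open>d\<close> is Hilbertian on \<open>X\<close> iff \<open>hilbertian_on TYPE('h) X d\<close> holds for some Hilbert space \<open>'h\<close>, and
  a theorem \<open>\<not> hilbertian_on TYPE('h) X d\<close> with a free type variable \<open>'h\<close> says that it is not
  Hilbertian. Real Hilbert spaces cover the complex ones, since a complex Hilbert
  space is a real one with the same norm under the real part of its inner product.\<close>

definition hilbertian_on ::
  "'h::{real_inner, complete_space} itself \<Rightarrow> 'a set \<Rightarrow> ('a \<Rightarrow> 'a \<Rightarrow> real) \<Rightarrow> bool" where
  "hilbertian_on H X d \<longleftrightarrow> (\<exists>\<Phi> :: 'a \<Rightarrow> 'h. \<forall>x\<in>X. \<forall>y\<in>X. d x y = norm (\<Phi> x - \<Phi> y))"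

lemma mat_adjoint_carrier: "A \<in> carrier_mat n m \<Longrightarrow> mat_adjoint A \<in> carrier_mat m n"
  by (auto simp: mat_adjoint_def mat_of_rows_def)

lemma mat_diag_mult_intertwine:
  fixes W :: "complex mat"
  assumes W: "W \<in> carrier_mat n n"
    and eq: "mat_diag n (\<lambda>i. complex_of_real (e i)) * W = W * mat_diag n (\<lambda>i. complex_of_real (d i))"
  shows "mat_diag n (\<lambda>i. complex_of_real (f (e i))) * W
       = W * mat_diag n (\<lambda>i. complex_of_real (f (d i)))"
proof -
  have L: "(mat_diag n g * W) $$ (i, j) = g i * W $$ (i, j)"
    if "i < n" "j < n" for g :: "nat \<Rightarrow> complex" and i j
    using that by (simp add: mat_diag_mult_left[OF W])
  have R: "(W * mat_diag n g) $$ (i, j) = W $$ (i, j) * g j"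
    if "i < n" "j < n" for g :: "nat \<Rightarrow> complex" and i j
    using that by (simp add: mat_diag_mult_right[OF W])
  show ?thesis
  proof (rule eq_matI)
    fix i j
    assume "i < dim_row (W * mat_diag n (\<lambda>i. complex_of_real (f (d i))))"
      and "j < dim_col (W * mat_diag n (\<lambda>i. complex_of_real (f (d i))))"
    then have ij: "i < n" "j < n"
      using W by (auto simp: mat_diag_def)
    have "complex_of_real (e i) * W $$ (i, j) = W $$ (i, j) * complex_of_real (d j)"
      using arg_cong[OF eq, of "\<lambda>M. M $$ (i, j)"] L[OF ij] R[OF ij] by simp
    then have "W $$ (i, j) = 0 \<or> e i = d j" by auto
    then show "(mat_diag n (\<lambda>i. complex_of_real (f (e i))) * W) $$ (i, j)
        = (W * mat_diag n (\<lambda>i. complex_of_real (f (d i)))) $$ (i, j)"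
      using L[OF ij] R[OF ij] by auto
  qed (use W in \<open>auto simp: mat_diag_def\<close>)
qed

lemma is_diagonalization_unique_fun:
  assumes 1: "is_diagonalization A U d" and 2: "is_diagonalization A V e"
  defines "n \<equiv> dim_row A"
  shows "U * mat_diag n (\<lambda>i. complex_of_real (f (d i))) * mat_adjoint U
       = V * mat_diag n (\<lambda>i. complex_of_real (f (e i))) * mat_adjoint V"
proof -
  define D where "D g = mat_diag n (\<lambda>i. complex_of_real (g i))" for g :: "nat \<Rightarrow> real"
  have D: "D g \<in> carrier_mat n n" for g by (simp add: D_def)
  have U: "U \<in> carrier_mat n n" "mat_adjoint U * U = 1\<^sub>m n" "U * mat_adjoint U = 1\<^sub>m n"
    and V: "V \<in> carrier_mat n n" "mat_adjoint V * V = 1\<^sub>m n" "V * mat_adjoint V = 1\<^sub>m n"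
    and AU: "A = U * D d * mat_adjoint U" and AV: "A = V * D e * mat_adjoint V"
    using 1 2 by (auto simp: is_diagonalization_def unitary_mats_def n_def D_def)
  note U' = mat_adjoint_carrier[OF U(1)] and V' = mat_adjoint_carrier[OF V(1)]
  define W where "W = mat_adjoint V * U"
  have W: "W \<in> carrier_mat n n" using U V' by (simp add: W_def)
  have VW: "V * W = U"
    unfolding W_def using assoc_mult_mat[OF V(1) V' U(1)] V U by simp
  have WU: "W * mat_adjoint U = mat_adjoint V"
    unfolding W_def using assoc_mult_mat[OF V' U(1) U'] U V' by simp
  note assoc = assoc_mult_mat[of _ n n _ n _ n] and closed = mult_carrier_mat[of _ n n _ n]
  have VV: "mat_adjoint V * (V * X) = X" if "X \<in> carrier_mat n n" for X
    using that assoc_mult_mat[OF V' V(1) that] V by simp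
  have "mat_adjoint V * A * U = mat_adjoint V * (V * (D e * W))"
    unfolding AV W_def using U V V' D by (simp add: assoc closed)
  also have "\<dots> = D e * W"
    using VV D W closed by blast
  finally have "mat_adjoint V * A * U = D e * W" .
  moreover have "mat_adjoint V * A * U = W * D d * (mat_adjoint U * U)"
    unfolding AU W_def using U(1) U' V' D by (simp add: assoc closed)
  then have "mat_adjoint V * A * U = W * D d"
    unfolding U(2) right_mult_one_mat[OF closed[OF W D]] .
  ultimately have "D e * W = W * D d" by (rule trans[OF sym])
  then have comm: "D (\<lambda>i. f (e i)) * W = W * D (\<lambda>i. f (d i))"
    unfolding D_def by (rule mat_diag_mult_intertwine[OF W])
  have "U * D (\<lambda>i. f (d i)) * mat_adjoint U = V * (W * D (\<lambda>i. f (d i))) * mat_adjoint U"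
    unfolding VW[symmetric] assoc_mult_mat[OF V(1) W D] ..
  also have "\<dots> = V * (D (\<lambda>i. f (e i)) * W) * mat_adjoint U"
    unfolding comm ..
  also have "\<dots> = V * D (\<lambda>i. f (e i)) * (W * mat_adjoint U)"
    using V(1) W D U' by (simp add: assoc closed)
  finally show ?thesis unfolding WU D_def .
qed

lemma mat_fun_eq:
  assumes "is_diagonalization A U d"
  shows "mat_fun f A = U * mat_diag (dim_row A) (\<lambda>i. complex_of_real (f (d i))) * mat_adjoint U"
  unfolding mat_fun_def
  by (rule the_equality) (use assms is_diagonalization_unique_fun[OF _ assms] in blast)+

end

theory Submission
  imports Defs
begin

text \<open>
  If \<open>sqrt J_eta\<close> is Hilbertian on a set, then \<open>\<Sum>\<^sub>i\<^sub>j c\<^sub>i c\<^sub>j Tr (eta ((A\<^sub>i + A\<^sub>j) / 2)) \<ge> 0\<close> for all points \<open>A\<^sub>i\<close>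
  of the set and all real weights \<open>c\<^sub>i\<close> with sum zero. On a 2 by 2 block with half trace \<open>t\<close> and
  eigenvalues \<open>t \<plusminus> r\<close> this fails: four non-commuting vertices \<open>t = 6\<close>, \<open>(x, y) = (\<plusminus>3, \<plusminus>4)\<close> with weight
  -1 and the two multiples \<open>t = 1, 11\<close> of the identity with weight 2 imitate a wave operator in
  \<open>(t, x, y)\<close>. Since 3, 4, 5 is a Pythagorean triple, all midpoints have integer eigenvalues, and the
  sum is negative because \<open>3\<^sup>9 5\<^sup>1\<^sup>0 < 11\<^sup>1\<^sup>1\<close>. For density matrices the points are scaled by \<open>1/42\<close> and a
  third diagonal entry \<open>(42 - 2 t) / 42\<close> normalises the trace; it perturbs the sum too little to change
  its sign.
\<close>

section \<open>Adjoints and traces of complex matrices\<close>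

lemma mat_adjoint_dim [simp]:
  "dim_row (mat_adjoint A) = dim_col A" "dim_col (mat_adjoint A) = dim_row A"
  by (auto simp: mat_adjoint_def mat_of_rows_def)

lemma mat_adjoint_index [simp]:
  fixes A :: "complex mat"
  shows "i < dim_col A \<Longrightarrow> j < dim_row A \<Longrightarrow> mat_adjoint A $$ (i, j) = cnj (A $$ (j, i))"
  by (auto simp: mat_adjoint_def mat_of_rows_def)

lemma mat_adjoint_mult:
  fixes A B :: "complex mat"
  assumes "A \<in> carrier_mat n k" "B \<in> carrier_mat k m"
  shows "mat_adjoint (A * B) = mat_adjoint B * mat_adjoint A"
  by (rule eq_matI) (use assms in \<open>auto simp: scalar_prod_def mult.commute\<close>)

lemma mat_adjoint_adjoint [simp]: "mat_adjoint (mat_adjoint A) = (A :: complex mat)"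
  by (rule eq_matI) auto

lemma mat_adjoint_real_diag [simp]:
  "mat_adjoint (mat_diag n (\<lambda>i. complex_of_real (d i))) = mat_diag n (\<lambda>i. complex_of_real (d i))"
  by (rule eq_matI) (auto simp: mat_diag_def)

lemma mat_adjoint_four_block:
  fixes A B C D :: "complex mat"
  assumes "A \<in> carrier_mat nr1 nc1" "B \<in> carrier_mat nr1 nc2"
    "C \<in> carrier_mat nr2 nc1" "D \<in> carrier_mat nr2 nc2"
  shows "mat_adjoint (four_block_mat A B C D) =
    four_block_mat (mat_adjoint A) (mat_adjoint C) (mat_adjoint B) (mat_adjoint D)"
  by (rule eq_matI) (use assms in auto)

lemma mat_adjoint_zero [simp]: "mat_adjoint (0\<^sub>m n m :: complex mat) = 0\<^sub>m m n"
  by (rule eq_matI) auto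

lemma mat_adjoint_cscalar_prod:
  fixes M :: "complex mat"
  assumes M: "M \<in> carrier_mat n m" and v: "v \<in> carrier_vec m" and w: "w \<in> carrier_vec n"
  shows "(M *\<^sub>v v) \<bullet>c w = v \<bullet>c (mat_adjoint M *\<^sub>v w)"
proof -
  have "(M *\<^sub>v v) \<bullet>c w = (\<Sum>i<n. \<Sum>j<m. M $$ (i, j) * v $ j * cnj (w $ i))"
    using assms by (simp add: scalar_prod_def sum_distrib_right atLeast0LessThan)
  also have "\<dots> = (\<Sum>j<m. \<Sum>i<n. M $$ (i, j) * v $ j * cnj (w $ i))"
    by (rule sum.swap)
  also have "\<dots> = v \<bullet>c (mat_adjoint M *\<^sub>v w)"
    using assms by (simp add: scalar_prod_def sum_distrib_left atLeast0LessThan mult_ac)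
  finally show ?thesis .
qed

lemma mat_trace_mult_commute:
  fixes A B :: "'a::comm_semiring_0 mat"
  assumes "A \<in> carrier_mat n m" "B \<in> carrier_mat m n"
  shows "mat_trace (A * B) = mat_trace (B * A)"
proof -
  have "mat_trace (A * B) = (\<Sum>i<n. \<Sum>j<m. A $$ (i, j) * B $$ (j, i))"
    using assms by (simp add: mat_trace_def scalar_prod_def atLeast0LessThan)
  also have "\<dots> = (\<Sum>j<m. \<Sum>i<n. A $$ (i, j) * B $$ (j, i))"
    by (rule sum.swap)
  also have "\<dots> = mat_trace (B * A)"
    using assms by (simp add: mat_trace_def scalar_prod_def atLeast0LessThan mult.commute)
  finally show ?thesis .
qed

section \<open>Trace and definiteness read off from a diagonalization\<close>

text \<open>Cyclicity of the trace brings \<open>U\<close> next to its adjoint, so only the diagonal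
  factor remains. Every trace in \<open>J_eta\<close> thereby becomes a sum over
  eigenvalues.\<close>

lemma mat_trace_mat_fun:
  assumes "is_diagonalization A U d"
  shows "mat_trace (mat_fun f A) = (\<Sum>i<dim_row A. complex_of_real (f (d i)))"
proof -
  define n where "n = dim_row A"
  define D where "D = mat_diag n (\<lambda>i. complex_of_real (f (d i)))"
  have U: "U \<in> carrier_mat n n" "mat_adjoint U * U = 1\<^sub>m n"
    using assms by (auto simp: is_diagonalization_def unitary_mats_def n_def)
  note U' = mat_adjoint_carrier[OF U(1)]
  have D: "D \<in> carrier_mat n n" by (simp add: D_def)
  have "mat_trace (mat_fun f A) = mat_trace (U * (D * mat_adjoint U))"
    using assoc_mult_mat[OF U(1) D U'] by (simp add: mat_fun_eq[OF assms] D_def n_def)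
  also have "\<dots> = mat_trace (D * mat_adjoint U * U)"
    using U U' D by (intro mat_trace_mult_commute) auto
  also have "D * mat_adjoint U * U = D"
    using U U' D by (simp add: assoc_mult_mat[of _ n n])
  finally show ?thesis by (simp add: D_def n_def mat_trace_def mat_diag_def)
qed

lemma is_diagonalization_hermitian:
  assumes "is_diagonalization A U d"
  shows "hermitian_mat A"
proof -
  define n where "n = dim_row A"
  define D where "D = mat_diag n (\<lambda>i. complex_of_real (d i))"
  have U: "U \<in> carrier_mat n n" and A: "A = U * D * mat_adjoint U"
    using assms by (auto simp: is_diagonalization_def unitary_mats_def n_def D_def)
  note U' = mat_adjoint_carrier[OF U]
  have D: "D \<in> carrier_mat n n" "mat_adjoint D = D" by (simp_all add: D_def)
  have "mat_adjoint A = U * mat_adjoint (U * D)"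
    unfolding A using U U' D by (subst mat_adjoint_mult[of _ n n]) auto
  also have "mat_adjoint (U * D) = D * mat_adjoint U"
    using U D by (subst mat_adjoint_mult[of _ n n]) auto
  finally show ?thesis
    using U U' D by (simp add: hermitian_mat_def A assoc_mult_mat[of _ n n])
qed

text \<open>In the coordinates \<open>mat_adjoint U\<close> applied to \<open>v\<close> the form is
  diagonal. This reduces (semi)definiteness to the signs of the \<open>d i\<close>.\<close>

lemma is_diagonalization_quadratic_form:
  assumes "is_diagonalization A U d" and v: "v \<in> carrier_vec (dim_row A)"
  shows "Re ((A *\<^sub>v v) \<bullet>c v) = (\<Sum>i<dim_row A. d i * (cmod ((mat_adjoint U *\<^sub>v v) $ i))\<^sup>2)"
proof -
  define n where "n = dim_row A"
  define D where "D = mat_diag n (\<lambda>i. complex_of_real (d i))"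
  have U: "U \<in> carrier_mat n n" and A: "A = U * D * mat_adjoint U"
    using assms by (auto simp: is_diagonalization_def unitary_mats_def n_def D_def)
  note U' = mat_adjoint_carrier[OF U]
  have D: "D \<in> carrier_mat n n" by (simp add: D_def)
  define u where "u = mat_adjoint U *\<^sub>v v"
  have u: "u \<in> carrier_vec n" using U' v by (simp add: u_def n_def)
  have Du: "(D *\<^sub>v u) $ i = d i * u $ i" if "i < n" for i
  proof -
    have "(D *\<^sub>v u) $ i = (\<Sum>j\<in>{0..<n}. if i = j then d j * u $ j else 0)"
      using that u by (simp add: D_def mat_diag_def scalar_prod_def if_distrib [of "\<lambda>x. x * _"] cong: if_cong)
    then show ?thesis using that by simp
  qed
  have "A *\<^sub>v v = U *\<^sub>v (D *\<^sub>v u)"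
    unfolding A u_def using U U' D v
    by (simp add: n_def assoc_mult_mat_vec[of _ n n _ n] del: assoc_mult_mat)
  then have "(A *\<^sub>v v) \<bullet>c v = (D *\<^sub>v u) \<bullet>c u"
    using mat_adjoint_cscalar_prod[of U n n "D *\<^sub>v u" v] U D u v by (simp add: u_def n_def)
  also have "\<dots> = (\<Sum>i<n. d i * (u $ i * cnj (u $ i)))"
    using u D Du by (simp add: scalar_prod_def atLeast0LessThan mult.assoc)
  finally show ?thesis
    by (simp add: n_def u_def complex_mult_cnj cmod_power2)
qed

lemma is_diagonalization_psd:
  assumes A: "is_diagonalization A U d" "A \<in> carrier_mat n n" and d: "\<And>i. i < n \<Longrightarrow> 0 \<le> d i"
  shows "A \<in> psd_mats n"
  using is_diagonalization_hermitian[OF A(1)] is_diagonalization_quadratic_form[OF A(1)] A(2) d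
  by (auto simp: psd_mats_def intro!: sum_nonneg)

lemma is_diagonalization_pd:
  assumes A: "is_diagonalization A U d" "A \<in> carrier_mat n n" and d: "\<And>i. i < n \<Longrightarrow> 0 < d i"
  shows "A \<in> pd_mats n"
proof -
  have U: "U \<in> carrier_mat n n" "U * mat_adjoint U = 1\<^sub>m n"
    using A by (auto simp: is_diagonalization_def unitary_mats_def)
  note U' = mat_adjoint_carrier[OF U(1)]
  have "0 < Re ((A *\<^sub>v v) \<bullet>c v)" if v: "v \<in> carrier_vec n" "v \<noteq> 0\<^sub>v n" for v
  proof -
    define u where "u = mat_adjoint U *\<^sub>v v"
    have u: "u \<in> carrier_vec n" using U' v by (simp add: u_def)
    \<comment> \<open>Since \<open>U\<close> inverts its adjoint, a nonzero \<open>v\<close> has a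
      nonzero coordinate vector \<open>u\<close>; a single nonzero coordinate then makes the sum of
      squares strictly positive.\<close>
    have "U *\<^sub>v u = v"
      using U U' v by (simp add: u_def flip: assoc_mult_mat_vec[of _ n n])
    then have "u \<noteq> 0\<^sub>v n" using U v by auto
    then obtain i where i: "i < n" "u $ i \<noteq> 0" using u by (auto simp: vec_eq_iff)
    have "0 < (\<Sum>i<n. d i * (cmod (u $ i))\<^sup>2)"
      by (rule sum_pos2[of _ i]) (use i d in \<open>auto intro!: mult_nonneg_nonneg less_imp_le[of 0 "d _"]\<close>)
    then show ?thesis
      using is_diagonalization_quadratic_form[OF A(1)] A(2) v by (simp add: u_def)
  qed
  then show ?thesis
    using is_diagonalization_hermitian[OF A(1)] A(2) by (auto simp: pd_mats_def)
qed

lemma pd_mats_subset_psd_mats: "pd_mats n \<subseteq> psd_mats n"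
proof
  fix A assume A: "A \<in> pd_mats n"
  have "0 \<le> Re ((A *\<^sub>v v) \<bullet>c v)" if "v \<in> carrier_vec n" for v
    by (cases "v = 0\<^sub>v n") (use A that in \<open>auto simp: pd_mats_def less_imp_le\<close>)
  then show "A \<in> psd_mats n" using A by (auto simp: pd_mats_def psd_mats_def)
qed

section \<open>Block matrices with explicit spectrum\<close>

text \<open>In terms of Pauli matrices this is \<open>t I + x sigma_z + y sigma_x\<close>, the
  general real symmetric 2 by 2 matrix in linear coordinates.\<close>

definition sym2 :: "real \<Rightarrow> real \<Rightarrow> real \<Rightarrow> complex mat" where
  "sym2 t x y = mat 2 2 (\<lambda>(i, j). complex_of_real
     (if i \<noteq> j then y else if i = 0 then t + x else t - x))"

lemma sym2_carrier [simp]: "sym2 t x y \<in> carrier_mat 2 2"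
  by (simp add: sym2_def)

text \<open>With (x, y) in polar form at angle \<theta>, the eigenvectors are the columns of the
  rotation by \<theta>/2; the double-angle formulas recover the entries.\<close>

lemma sym2_diagonalization:
  assumes r: "0 \<le> r" "r\<^sup>2 = x\<^sup>2 + y\<^sup>2"
  shows "\<exists>U. is_diagonalization (sym2 t x y) U (\<lambda>i. if i = 0 then t + r else t - r)"
proof -
  obtain \<theta> where xy: "x = r * cos \<theta>" "y = r * sin \<theta>"
  proof -
    obtain \<rho> \<theta> where *: "x = \<rho> * cos \<theta>" "y = \<rho> * sin \<theta>" using polar_Ex by blast
    have "r\<^sup>2 = \<rho>\<^sup>2 * ((sin \<theta>)\<^sup>2 + (cos \<theta>)\<^sup>2)"
      unfolding r(2) * power_mult_distrib by (simp only: algebra_simps)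
    \<comment> \<open>The radius \<rho> obtained from \<open>polar_Ex\<close> may be negative; in
      that case adding \<open>pi\<close> to the angle flips both signs.\<close>
    then have "r = \<rho> \<or> r = - \<rho>" by (simp add: power2_eq_iff)
    then show thesis
      using that[of \<theta>] that[of "\<theta> + pi"] * by auto
  qed
  define c s where "c = cos (\<theta> / 2)" and "s = sin (\<theta> / 2)"
  have cs: "c * c + s * s = 1"
    using sin_cos_squared_add[of "\<theta> / 2"] by (simp add: c_def s_def power2_eq_square)
  have cos2: "cos \<theta> = c * c - s * s" and sin2: "sin \<theta> = 2 * s * c"
    using cos_double[of "\<theta> / 2"] sin_double[of "\<theta> / 2"]
    by (simp_all add: c_def s_def power2_eq_square)
  define U :: "complex mat" where "U = mat 2 2 (\<lambda>(i, j). complex_of_real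
     (if i = j then c else if i = 0 then - s else s))"
  have tx: "t + x = c * (t + r) * c + s * (t - r) * s"
    "t - x = s * (t + r) * s + c * (t - r) * c"
    "y = c * (t + r) * s - s * (t - r) * c"
  proof -
    have "t + x = t * (c * c + s * s) + x" "t - x = t * (c * c + s * s) - x" using cs by simp_all
    then show "t + x = c * (t + r) * c + s * (t - r) * s"
      "t - x = s * (t + r) * s + c * (t - r) * c" "y = c * (t + r) * s - s * (t - r) * c"
      by (simp_all add: xy cos2 sin2 algebra_simps)
  qed
  have less2: "i < 2 \<longleftrightarrow> i = 0 \<or> i = Suc 0" for i :: nat by auto
  have sum2: "(\<Sum>k\<in>{0..<2}. f k) = f 0 + f (Suc 0)" for f :: "nat \<Rightarrow> complex"
    by (simp add: numeral_2_eq_2)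
  have [simp]: "dim_row (sym2 t x y) = 2" "dim_col (sym2 t x y) = 2" by (simp_all add: sym2_def)
  have cs': "complex_of_real c * c + complex_of_real s * s = 1"
    using arg_cong[OF cs, of complex_of_real] by simp
  have "mat_adjoint U * U = 1\<^sub>m 2" "U * mat_adjoint U = 1\<^sub>m 2"
    using cs' by (auto simp: U_def less2 scalar_prod_def sum2 add.commute intro!: eq_matI)
  moreover have "sym2 t x y = U * mat_diag 2 (\<lambda>i. complex_of_real (if i = 0 then t + r else t - r))
      * mat_adjoint U" (is "_ = ?R")
  proof (rule eq_matI)
    fix i j assume "i < dim_row ?R" "j < dim_col ?R"
    then have "i = 0 \<or> i = Suc 0" "j = 0 \<or> j = Suc 0" by (auto simp: U_def less2)
    moreover have "complex_of_real (t + x) = complex_of_real (c * (t + r) * c + s * (t - r) * s)"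
      "complex_of_real (t - x) = complex_of_real (s * (t + r) * s + c * (t - r) * c)"
      "complex_of_real y = complex_of_real (c * (t + r) * s - s * (t - r) * c)"
      unfolding tx by (rule refl)+
    ultimately show "sym2 t x y $$ (i, j) = ?R $$ (i, j)"
      by (auto simp: sym2_def U_def mat_diag_def scalar_prod_def sum2)
  qed (auto simp: U_def)
  moreover have "U \<in> carrier_mat 2 2" by (simp add: U_def)
  ultimately show ?thesis
    unfolding is_diagonalization_def unitary_mats_def by auto
qed

text \<open>The 2 by 2 block carries the non-commutativity. The diagonal tail \<open>w\<close> fills
  up the dimension: it keeps the matrix positive definite, or supplies the missing trace of a
  density matrix.\<close>

definition block :: "nat \<Rightarrow> real \<Rightarrow> real \<Rightarrow> real \<Rightarrow> (nat \<Rightarrow> real) \<Rightarrow> complex mat" where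
  "block m t x y w = four_block_mat (sym2 t x y) (0\<^sub>m 2 m) (0\<^sub>m m 2)
     (mat_diag m (\<lambda>k. complex_of_real (w k)))"

definition block_spec :: "real \<Rightarrow> real \<Rightarrow> (nat \<Rightarrow> real) \<Rightarrow> nat \<Rightarrow> real" where
  "block_spec t r w i = (if i = 0 then t + r else if i = 1 then t - r else w (i - 2))"

lemma block_carrier [simp]: "block m t x y w \<in> carrier_mat (2 + m) (2 + m)"
  unfolding block_def by (intro four_block_carrier_mat) auto

lemma block_dim [simp]: "dim_row (block m t x y w) = 2 + m" "dim_col (block m t x y w) = 2 + m"
  using block_carrier[of m t x y w] by (auto simp del: block_carrier)

text \<open>The unitary is the direct sum of one diagonalizing the 2 by 2 block and the identity on
  the tail.\<close>

lemma block_diagonalization: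
  assumes r: "0 \<le> r" "r\<^sup>2 = x\<^sup>2 + y\<^sup>2"
  shows "\<exists>U. is_diagonalization (block m t x y w) U (block_spec t r w)"
proof -
  obtain V where "is_diagonalization (sym2 t x y) V (\<lambda>i. if i = 0 then t + r else t - r)"
    using sym2_diagonalization[OF r] by blast
  moreover define D :: "complex mat" where
    "D = mat_diag 2 (\<lambda>i. complex_of_real (if i = 0 then t + r else t - r))"
  moreover have "dim_row (sym2 t x y) = 2" by (simp add: sym2_def)
  ultimately have V: "V \<in> carrier_mat 2 2" "mat_adjoint V * V = 1\<^sub>m 2" "V * mat_adjoint V = 1\<^sub>m 2"
    and S: "sym2 t x y = V * D * mat_adjoint V"
    by (auto simp: is_diagonalization_def unitary_mats_def)
  note V' = mat_adjoint_carrier[OF V(1)]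
  have D: "D \<in> carrier_mat 2 2" by (simp add: D_def)
  define W where "W = mat_diag m (\<lambda>k. complex_of_real (w k))"
  have W: "W \<in> carrier_mat m m" by (simp add: W_def)
  have one: "mat_adjoint (1\<^sub>m m :: complex mat) = 1\<^sub>m m"
    by (rule eq_matI) auto
  define U where "U = four_block_mat V (0\<^sub>m 2 m) (0\<^sub>m m 2) (1\<^sub>m m)"
  have U: "U \<in> carrier_mat (2 + m) (2 + m)"
    unfolding U_def by (rule four_block_carrier_mat) (use V in auto)
  have U': "mat_adjoint U = four_block_mat (mat_adjoint V) (0\<^sub>m 2 m) (0\<^sub>m m 2) (1\<^sub>m m)"
    unfolding U_def using V by (subst mat_adjoint_four_block[of _ 2 2 _ m _ m]) (auto simp: one)
  have E: "mat_diag (2 + m) (\<lambda>i. complex_of_real (block_spec t r w i)) =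
      four_block_mat D (0\<^sub>m 2 m) (0\<^sub>m m 2) W"
    by (rule eq_matI) (auto simp: mat_diag_def D_def W_def block_spec_def)
  have "mat_adjoint U * U = 1\<^sub>m (2 + m)" "U * mat_adjoint U = 1\<^sub>m (2 + m)"
    unfolding U' unfolding U_def using V V'
    by (subst mult_four_block_mat[of _ 2 2 _ m _ m _ _ 2 _ m], auto)+
  moreover have "block m t x y w = U * mat_diag (2 + m) (\<lambda>i. complex_of_real (block_spec t r w i))
      * mat_adjoint U"
  proof -
    have "U * four_block_mat D (0\<^sub>m 2 m) (0\<^sub>m m 2) W = four_block_mat (V * D) (0\<^sub>m 2 m) (0\<^sub>m m 2) W"
      unfolding U_def using V D W
      by (subst mult_four_block_mat[of _ 2 2 _ m _ m _ _ 2 _ m]) auto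
    then show ?thesis
      unfolding E U' using V V' D W S
      by (simp add: mult_four_block_mat[of _ 2 2 _ m _ m _ _ 2 _ m] block_def W_def[symmetric])
  qed
  ultimately show ?thesis
    using U unfolding is_diagonalization_def unitary_mats_def by auto
qed

lemma sum_block_spec:
  "(\<Sum>i<2 + m. f (block_spec t r w i)) = f (t + r) + f (t - r) + (\<Sum>k<m. f (w k))"
  for f :: "real \<Rightarrow> 'a::comm_monoid_add"
  unfolding add_2_eq_Suc sum.lessThan_Suc_shift by (simp add: block_spec_def add.assoc)

lemma trace_mat_fun_block:
  assumes "0 \<le> r" "r\<^sup>2 = x\<^sup>2 + y\<^sup>2"
  shows "Re (mat_trace (mat_fun f (block m t x y w))) = f (t + r) + f (t - r) + (\<Sum>k<m. f (w k))"
proof -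
  obtain U where "is_diagonalization (block m t x y w) U (block_spec t r w)"
    using block_diagonalization[OF assms] by blast
  then show ?thesis
    using sum_block_spec[of f] by (simp add: mat_trace_mat_fun del: add_2_eq_Suc)
qed

lemma block_pd:
  assumes "0 \<le> r" "r\<^sup>2 = x\<^sup>2 + y\<^sup>2" "r < t" "\<And>k. k < m \<Longrightarrow> 0 < w k"
  shows "block m t x y w \<in> pd_mats (2 + m)"
proof -
  obtain U where "is_diagonalization (block m t x y w) U (block_spec t r w)"
    using block_diagonalization[OF assms(1,2)] by blast
  then show ?thesis
    by (rule is_diagonalization_pd) (use assms in \<open>auto simp: block_spec_def\<close>)
qed

lemma block_density:
  assumes "0 \<le> r" "r\<^sup>2 = x\<^sup>2 + y\<^sup>2" "r \<le> t" "\<And>k. k < m \<Longrightarrow> 0 \<le> w k" "2 * t + (\<Sum>k<m. w k) = 1"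
  shows "block m t x y w \<in> density_mats (2 + m)"
proof -
  obtain U where "is_diagonalization (block m t x y w) U (block_spec t r w)"
    using block_diagonalization[OF assms(1,2)] by blast
  then have "block m t x y w \<in> psd_mats (2 + m)"
    by (rule is_diagonalization_psd) (use assms in \<open>auto simp: block_spec_def\<close>)
  moreover have "mat_trace (block m t x y w) = complex_of_real (2 * t + (\<Sum>k<m. w k))"
    unfolding mat_trace_def block_dim add_2_eq_Suc sum.lessThan_Suc_shift
    by (simp add: block_def sym2_def mat_diag_def)
  ultimately show ?thesis using assms(5) by (simp add: density_mats_def)
qed

text \<open>The entries are linear in the parameters, so midpoints stay in the family and
  \<open>trace_mat_fun_block\<close> evaluates the midpoint term of \<open>J_eta\<close> as
  well.\<close>

lemma block_average:
  "(1/2) \<cdot>\<^sub>m (block m t x y w + block m t' x' y' w') =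
    block m ((t + t') / 2) ((x + x') / 2) ((y + y') / 2) (\<lambda>k. (w k + w' k) / 2)"
  by (rule eq_matI) (auto simp: block_def sym2_def mat_diag_def add_divide_distrib diff_divide_distrib)

section \<open>Hilbertian metrics and conditional negative definiteness\<close>

lemma hilbertian_on_subset: "hilbertian_on H Y d \<Longrightarrow> X \<subseteq> Y \<Longrightarrow> hilbertian_on H X d"
  unfolding hilbertian_on_def by blast

text \<open>Schoenberg's condition for squared Hilbert distances. After expanding the square, the
  terms depending on only one of \<open>\<phi> i\<close>, \<open>\<phi> j\<close> meet the zero
  total weight; the inner products form a Gram sum.\<close>

lemma sum_norm_diff_sq:
  fixes \<phi> :: "'i \<Rightarrow> 'h::real_inner" and c :: "'i \<Rightarrow> real"
  assumes "sum c I = 0"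
  shows "(\<Sum>i\<in>I. \<Sum>j\<in>I. c i * c j * (norm (\<phi> i - \<phi> j))\<^sup>2) = - 2 * (norm (\<Sum>i\<in>I. c i *\<^sub>R \<phi> i))\<^sup>2"
proof -
  have 1: "(\<Sum>i\<in>I. \<Sum>j\<in>I. c i * c j * g i) = 0" "(\<Sum>i\<in>I. \<Sum>j\<in>I. c i * c j * g j) = 0" for g
  proof -
    have "(\<Sum>i\<in>I. \<Sum>j\<in>I. c i * c j * g i) = (\<Sum>i\<in>I. c i * g i * sum c I)"
      by (simp add: sum_distrib_left mult_ac)
    then show "(\<Sum>i\<in>I. \<Sum>j\<in>I. c i * c j * g i) = 0" using assms by simp
    have "(\<Sum>i\<in>I. \<Sum>j\<in>I. c i * c j * g j) = sum c I * (\<Sum>j\<in>I. c j * g j)"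
      by (simp add: sum_product mult.assoc)
    then show "(\<Sum>i\<in>I. \<Sum>j\<in>I. c i * c j * g j) = 0" using assms by simp
  qed
  have "(\<Sum>i\<in>I. \<Sum>j\<in>I. c i * c j * (norm (\<phi> i - \<phi> j))\<^sup>2) =
      (\<Sum>i\<in>I. \<Sum>j\<in>I. c i * c j * (norm (\<phi> i))\<^sup>2 + c i * c j * (norm (\<phi> j))\<^sup>2
        - 2 * (c i * c j * inner (\<phi> i) (\<phi> j)))"
    by (intro sum.cong refl)
      (simp add: power2_norm_eq_inner inner_diff_left inner_diff_right inner_commute algebra_simps)
  also have "\<dots> = - 2 * (\<Sum>i\<in>I. \<Sum>j\<in>I. c i * c j * inner (\<phi> i) (\<phi> j))"
    by (simp add: sum.distrib sum_subtractf 1 flip: sum_distrib_left)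
  also have "(\<Sum>i\<in>I. \<Sum>j\<in>I. c i * c j * inner (\<phi> i) (\<phi> j)) = (norm (\<Sum>i\<in>I. c i *\<^sub>R \<phi> i))\<^sup>2"
    unfolding power2_norm_eq_inner inner_sum_left inner_sum_right
    by (intro sum.cong refl) (simp add: mult.assoc inner_commute)
  finally show ?thesis .
qed

text \<open>Weights of total mass zero cancel the diagonal terms of \<^const>\<open>J_eta\<close>, leaving the kernel of midpoints.\<close>

lemma hilbertian_J_eta_midpoints:
  fixes c :: "'i \<Rightarrow> real" and P :: "'i \<Rightarrow> complex mat"
  assumes H: "hilbertian_on TYPE('h::{real_inner, complete_space}) X (\<lambda>A B. sqrt (J_eta A B))"
    and P: "\<And>i. i \<in> I \<Longrightarrow> P i \<in> X" and c: "sum c I = 0"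
  shows "0 \<le> (\<Sum>i\<in>I. \<Sum>j\<in>I. c i * c j * Re (mat_trace (mat_fun eta ((1/2) \<cdot>\<^sub>m (P i + P j)))))"
    (is "0 \<le> ?S")
proof -
  obtain \<Phi> :: "complex mat \<Rightarrow> 'h" where \<Phi>: "\<And>A B. A \<in> X \<Longrightarrow> B \<in> X \<Longrightarrow> sqrt (J_eta A B) = norm (\<Phi> A - \<Phi> B)"
    using H unfolding hilbertian_on_def by blast
  have J: "J_eta (P i) (P j) = (norm (\<Phi> (P i) - \<Phi> (P j)))\<^sup>2" if "i \<in> I" "j \<in> I" for i j
  proof -
    \<comment> \<open>The real \<open>sqrt\<close> is odd, hence negative on negative numbers, so
      its equality with a norm forces a nonnegative argument.\<close>
    have "0 \<le> J_eta (P i) (P j)"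
      using \<Phi>[OF P P, OF that] norm_ge_zero real_sqrt_ge_0_iff by metis
    then show ?thesis using \<Phi>[OF P P, OF that] by (metis real_sqrt_pow2)
  qed
  define g where "g i = 1/2 * Re (mat_trace (mat_fun eta (P i)))" for i
  have "(\<Sum>i\<in>I. \<Sum>j\<in>I. c i * c j * J_eta (P i) (P j)) =
      (\<Sum>i\<in>I. c i * g i) * sum c I + sum c I * (\<Sum>i\<in>I. c i * g i) - ?S"
    unfolding sum_product sum.distrib[symmetric] sum_subtractf[symmetric]
    by (intro sum.cong refl) (simp add: J_eta_def g_def algebra_simps)
  also have "\<dots> = - ?S" using c by simp
  finally have "?S = - (\<Sum>i\<in>I. \<Sum>j\<in>I. c i * c j * (norm (\<Phi> (P i) - \<Phi> (P j)))\<^sup>2)"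
    using J by simp
  also have "\<dots> = 2 * (norm (\<Sum>i\<in>I. c i *\<^sub>R \<Phi> (P i)))\<^sup>2"
    using sum_norm_diff_sq[OF c, of "\<lambda>i. \<Phi> (P i)"] by simp
  finally show ?thesis by simp
qed

section \<open>The six-point configuration\<close>

text \<open>Indices 0 to 3 are the vertices, 4 and 5 the multiples of the identity. The values 1 and
  11 are 6 - 5 and 6 + 5, so a midpoint of a vertex with such a multiple has eigenvalues 1, 6 or 6,
  11, all of which occur among the other midpoints.\<close>

definition config_t :: "nat \<Rightarrow> real" where "config_t i = [6, 6, 6, 6, 1, 11] ! i"
definition config_x :: "nat \<Rightarrow> real" where "config_x i = [3, 3, -3, -3, 0, 0] ! i"
definition config_y :: "nat \<Rightarrow> real" where "config_y i = [4, -4, 4, -4, 0, 0] ! i"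
definition config_c :: "nat \<Rightarrow> real" where "config_c i = [-1, -1, -1, -1, 2, 2] ! i"

lemmas config_defs = config_t_def config_x_def config_y_def config_c_def

lemma sum_lessThan_6: "(\<Sum>i<6. f i) = f 0 + f 1 + f 2 + f 3 + f 4 + f (5::nat)"
  for f :: "nat \<Rightarrow> real"
  by (simp add: eval_nat_numeral)

text \<open>Here \<open>h\<close> acts on the two block eigenvalues and \<open>g\<close> stands for
  the tail. The coefficients 1, -4, 6, -4, 1 of \<open>g\<close> form a fourth difference with step
  5/2, which is why a smooth tail contributes little.\<close>

lemma config_midpoint_sum:
  fixes g h :: "real \<Rightarrow> real"
  defines "R \<equiv> \<lambda>i j. sqrt (((config_x i + config_x j) / 2)\<^sup>2 + ((config_y i + config_y j) / 2)\<^sup>2)"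
    and "t \<equiv> \<lambda>i j. (config_t i + config_t j) / 2"
  shows "(\<Sum>i<6. \<Sum>j<6. config_c i * config_c j * (h (t i j + R i j) + h (t i j - R i j) + g (t i j)))
    = 4 * (h 9 + h 3 + h 10 + h 2 - h 11 - h 1 - 2 * h 6)
      + 4 * (6 * g 6 + g 1 + g 11 - 4 * g (7/2) - 4 * g (17/2))"
proof -
  \<comment> \<open>Squared midpoint radii: 25 for a vertex with itself, 9 or 16 for two vertices
    sharing only \<open>x\<close> or only \<open>y\<close>, 25/4 for a vertex with a multiple of the
    identity. All others vanish.\<close>
  have sqrts: "sqrt 9 = 3" "sqrt 16 = 4" "sqrt 25 = 5" "sqrt (25/4) = 5/2"
    by (rule real_sqrt_unique; simp add: power2_eq_square)+
  show ?thesis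
    unfolding R_def t_def sum_lessThan_6 config_defs
    by (simp add: power2_eq_square sqrts)
qed

text \<open>Common source of both contradictions, with the midpoint sum divided by 4. The scale
  \<open>a\<close> will be 1 or 1/42; the tail may vary with the point as long as its midpoint
  contribution depends only on the mean of \<open>config_t\<close>.\<close>

lemma hilbertian_config:
  fixes g :: "real \<Rightarrow> real"
  assumes H: "hilbertian_on TYPE('h::{real_inner, complete_space}) S (\<lambda>A B. sqrt (J_eta A B))"
    and a: "0 < a"
    and S: "\<And>i. i < 6 \<Longrightarrow> block m (a * config_t i) (a * config_x i) (a * config_y i) (w i) \<in> S"
    and g: "\<And>i j. i < 6 \<Longrightarrow> j < 6 \<Longrightarrow>
      (\<Sum>k<m. eta ((w i k + w j k) / 2)) = g ((config_t i + config_t j) / 2)"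
  shows "0 \<le> eta (a * 9) + eta (a * 3) + eta (a * 10) + eta (a * 2) - eta (a * 11) - eta (a * 1)
      - 2 * eta (a * 6) + (6 * g 6 + g 1 + g 11 - 4 * g (7/2) - 4 * g (17/2))"
proof -
  define t where "t i j = (config_t i + config_t j) / 2" for i j
  define R where "R i j = sqrt (((config_x i + config_x j) / 2)\<^sup>2 + ((config_y i + config_y j) / 2)\<^sup>2)" for i j
  define P where "P i = block m (a * config_t i) (a * config_x i) (a * config_y i) (w i)" for i
  have "sum config_c {..<6} = 0"
    by (simp add: sum_lessThan_6 config_c_def)
  then have "0 \<le> (\<Sum>i<6. \<Sum>j<6. config_c i * config_c j *
      Re (mat_trace (mat_fun eta ((1/2) \<cdot>\<^sub>m (P i + P j)))))"
    using S by (intro hilbertian_J_eta_midpoints[OF H]) (auto simp: P_def)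
  moreover have "Re (mat_trace (mat_fun eta ((1/2) \<cdot>\<^sub>m (P i + P j)))) =
      eta (a * (t i j + R i j)) + eta (a * (t i j - R i j)) + g (t i j)" if "i < 6" "j < 6" for i j
  proof -
    have ax: "(a * u + a * v) / 2 = a * ((u + v) / 2)" for u v by (simp add: algebra_simps)
    have "(a * R i j)\<^sup>2 = (a * ((config_x i + config_x j) / 2))\<^sup>2 + (a * ((config_y i + config_y j) / 2))\<^sup>2"
      unfolding power_mult_distrib R_def by (simp add: algebra_simps)
    moreover have "0 \<le> a * R i j" using a by (simp add: R_def)
    ultimately show ?thesis
      unfolding P_def block_average ax t_def distrib_left right_diff_distrib
      by (subst trace_mat_fun_block) (use g[OF that] in auto)
  qed
  ultimately show ?thesis
    using config_midpoint_sum[of "\<lambda>x. eta (a * x)" g] by (simp add: R_def t_def)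
qed

section \<open>Contradiction from exact integer inequalities\<close>

lemma less_6_cases: "i < (6::nat) \<Longrightarrow> i = 0 \<or> i = 1 \<or> i = 2 \<or> i = 3 \<or> i = 4 \<or> i = 5"
  by auto

lemma not_hilbertian_pd:
  "\<not> hilbertian_on TYPE('h::{real_inner, complete_space}) (pd_mats (2 + m)) (\<lambda>A B. sqrt (J_eta A B))"
proof
  assume H: "hilbertian_on TYPE('h) (pd_mats (2 + m)) (\<lambda>A B. sqrt (J_eta A B))"
  \<comment> \<open>A tail of ones costs nothing because \<open>eta 1 = 0\<close>, so
    \<open>g\<close> is zero. The block radius is 5 at the vertices and 0 otherwise, always below
    \<open>config_t i\<close>.\<close>
  have "block m (1 * config_t i) (1 * config_x i) (1 * config_y i) (\<lambda>_. 1) \<in> pd_mats (2 + m)"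
    if "i < 6" for i
    using less_6_cases[OF that]
    by (intro block_pd[of "if i < 4 then 5 else 0"]) (auto simp: config_defs)
  from hilbertian_config[OF H _ this, of "\<lambda>_. 0"]
  have "11 * ln 11 + 12 * ln 6 \<le> 9 * ln 9 + 3 * ln 3 + 10 * ln 10 + 2 * ln (2::real)"
    by (simp add: eta_def)
  \<comment> \<open>Both sides become logarithms of integers; cancelling the common factor 2^12 3^12
    would leave 11^11 at most 3^9 5^10, which is false.\<close>
  also have "11 * ln 11 + 12 * ln 6 = ln (11 ^ 11 * 6 ^ 12 :: real)"
    by (simp add: ln_mult ln_realpow del: power_numeral)
  also have "9 * ln 9 + 3 * ln 3 + 10 * ln 10 + 2 * ln 2 = ln (9 ^ 9 * 3 ^ 3 * 10 ^ 10 * 2 ^ 2 :: real)"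
    by (simp add: ln_mult ln_realpow del: power_numeral)
  finally show False by simp
qed

lemma not_hilbertian_density:
  assumes "0 < m"
  shows "\<not> hilbertian_on TYPE('h::{real_inner, complete_space}) (density_mats (2 + m)) (\<lambda>A B. sqrt (J_eta A B))"
proof
  assume H: "hilbertian_on TYPE('h) (density_mats (2 + m)) (\<lambda>A B. sqrt (J_eta A B))"
  \<comment> \<open>Entry 0 supplies the missing trace and is at least 20/42; \<open>0 < m\<close>
    provides room for it. The remaining entries are 0, where \<open>eta\<close> vanishes.\<close>
  define w :: "nat \<Rightarrow> nat \<Rightarrow> real" where "w i k = (if k = 0 then 1/42 * (42 - 2 * config_t i) else 0)" for i k
  have sum0: "(\<Sum>k<m. f k) = f 0" if "\<And>k. 0 < k \<Longrightarrow> f k = 0" for f :: "nat \<Rightarrow> real"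
    using that assms by (subst sum.remove[of _ 0]) auto
  have "block m (1/42 * config_t i) (1/42 * config_x i) (1/42 * config_y i) (w i) \<in> density_mats (2 + m)"
    if "i < 6" for i
    using less_6_cases[OF that]
    by (intro block_density[of "1/42 * (if i < 4 then 5 else 0)"])
      (auto simp: config_defs w_def sum0 power2_eq_square assms)
  moreover have "(\<Sum>k<m. eta ((w i k + w j k) / 2)) = eta (1/42 * (42 - 2 * ((config_t i + config_t j) / 2)))" for i j
  proof -
    have "(w i 0 + w j 0) / 2 = 1/42 * (42 - 2 * ((config_t i + config_t j) / 2))"
      by (simp add: w_def field_simps)
    moreover have "(\<Sum>k<m. eta ((w i k + w j k) / 2)) = eta ((w i 0 + w j 0) / 2)"
      by (rule sum0) (simp add: w_def eta_def)
    ultimately show ?thesis by (simp only:)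
  qed
  \<comment> \<open>The numbers 40, 35, 30, 25, 20 are \<open>42 - 2 * t\<close> at t = 1, 7/2, 6,
    17/2, 11.\<close>
  ultimately have "0 \<le> eta (1/42 * 9) + eta (1/42 * 3) + eta (1/42 * 10) + eta (1/42 * 2) - eta (1/42 * 11)
      - eta (1/42 * 1) - 2 * eta (1/42 * 6) + (6 * eta (1/42 * 30) + eta (1/42 * 40) + eta (1/42 * 20)
      - 4 * eta (1/42 * 35) - 4 * eta (1/42 * 25))"
    using hilbertian_config[OF H, of "1/42" m w "\<lambda>t. eta (1/42 * (42 - 2 * t))"] by simp
  \<comment> \<open>In the block terms and in the tail terms alike, the arguments weighted by their
    coefficients sum to zero, so every \<open>ln 42\<close> cancels and the scale 1/42 factors
    out.\<close>
  moreover have "eta (1/42 * x) = 1/42 * (x * ln x - x * ln 42)" if "0 < x" for x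
    using that by (simp add: eta_def ln_div right_diff_distrib)
  ultimately have "11 * ln 11 + 12 * ln 6 + 140 * ln 35 + 100 * ln 25 \<le>
      9 * ln 9 + 3 * ln 3 + 10 * ln 10 + 2 * ln 2 + 180 * ln 30 + 40 * ln 40 + 20 * ln (20::real)"
    by (simp only: zero_less_numeral zero_less_one ln_one) (simp add: field_simps)
  also have "11 * ln 11 + 12 * ln 6 + 140 * ln 35 + 100 * ln 25 =
      ln (11 ^ 11 * 6 ^ 12 * 35 ^ 140 * 25 ^ 100 :: real)"
    by (simp add: ln_mult ln_realpow del: power_numeral)
  also have "9 * ln 9 + 3 * ln 3 + 10 * ln 10 + 2 * ln 2 + 180 * ln 30 + 40 * ln 40 + 20 * ln 20 =
      ln (9 ^ 9 * 3 ^ 3 * 10 ^ 10 * 2 ^ 2 * 30 ^ 180 * 40 ^ 40 * 20 ^ 20 :: real)"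
    by (simp add: ln_mult ln_realpow del: power_numeral)
  finally show False by simp
qed

theorem theorem1p6:
  fixes n :: nat
  shows
    "(n \<ge> 2 \<longrightarrow>
        \<not> hilbertian_on TYPE('h::{real_inner, complete_space}) (pd_mats n) (\<lambda>A B. sqrt (J_eta A B)) \<and>
        \<not> hilbertian_on TYPE('h) (psd_mats n) (\<lambda>A B. sqrt (J_eta A B))) \<and>
     (n \<ge> 3 \<longrightarrow>
        \<not> hilbertian_on TYPE('h) (density_mats n) (\<lambda>A B. sqrt (J_eta A B)))"
proof (intro conjI impI)
  assume "2 \<le> n"
  then have n: "n = 2 + (n - 2)" by simp
  show "\<not> hilbertian_on TYPE('h) (pd_mats n) (\<lambda>A B. sqrt (J_eta A B))"
    by (subst n) (rule not_hilbertian_pd)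
  then show "\<not> hilbertian_on TYPE('h) (psd_mats n) (\<lambda>A B. sqrt (J_eta A B))"
    using hilbertian_on_subset[OF _ pd_mats_subset_psd_mats] by blast
next
  assume "3 \<le> n"
  then have n: "n = 2 + (n - 2)" "0 < n - 2" by simp_all
  show "\<not> hilbertian_on TYPE('h) (density_mats n) (\<lambda>A B. sqrt (J_eta A B))"
    by (subst n(1)) (rule not_hilbertian_density[OF n(2)])
qed

end
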